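(* For $d\ge5$, every integer $r$ with $\lfloor\frac{d+2}{2}\rfloor\le r\le d-2$ is a typical almost real rank for binary forms of degree $d$; that is, there is a nonempty Euclidean open subset of $\mathbb{R}[x,y]_d\cong\mathbb{R}^{d+1}$ all of whose elements have almost real rank equal to $r$.
   Context: $\mathbb{R}[x,y]_d$ is the space of binary forms of degree $d$. For $f\in\mathbb{R}[x,y]$ let $\partial(f)$ be the differential operator obtained by replacing $x,y$ by $\partial/\partial x,\partial/\partial y$. For a nonzero form $F\in\mathbb{R}[x,y]_d$, the apolar ideal is the homogeneous ideal $(F)^\perp=\{f\in\mathbb{R}[x,y]:\partial(f)\bullet F=0\}$, with degree-$r$ part $(F)^\perp_r$. A nonzero form $g\in\mathbb{R}[x,y]_r$ has almost real roots if it has at least $r-2$ simple (i.e. multiplicity-one, pairwise non-proportional) linear factors over $\mathbb{R}$; for $r\ge2$ this means $g=q\prod_{i=1}^{r-2}l_i$ over $\mathbb{R}$ with $l_i$ linear, $q$ quadratic, and $l_1,\dots,l_{r-2},q$ pairwise relatively prime. The almost real rank $\operatorname{ar-rk}(F)$ is the minimal $r$ such that there exists a nonzero $g\in(F)^\perp_r$ with almost real roots. *)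

theory Defs
  imports "HOL-Analysis.Analysis" "HOL-Computational_Algebra.Polynomial"
begin

(* The ring R[x,y] is taken to be R[x][y] = real poly poly: the coefficient of x^i y^j in F is
   coeff (coeff F j) i. *)

type_synonym bipoly = "real poly poly"

definition bicoeff :: "bipoly \<Rightarrow> nat \<Rightarrow> nat \<Rightarrow> real" where
  "bicoeff F i j = coeff (coeff F j) i"

definition forms :: "nat \<Rightarrow> bipoly set" where
  "forms d = {F. \<forall>i j. bicoeff F i j \<noteq> 0 \<longrightarrow> i + j = d}"

definition diff_x :: "bipoly \<Rightarrow> bipoly" where
  "diff_x F = map_poly pderiv F"

definition diff_y :: "bipoly \<Rightarrow> bipoly" where
  "diff_y F = pderiv F"

(* The coefficients of f beyond the two bounds vanish. *)
definition diff_op :: "bipoly \<Rightarrow> bipoly \<Rightarrow> bipoly" where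
  "diff_op f F = (\<Sum>j\<le>degree f. \<Sum>i\<le>degree (coeff f j).
     smult [:bicoeff f i j:] ((diff_x ^^ i) ((diff_y ^^ j) F)))"

definition apolar_ideal :: "bipoly \<Rightarrow> bipoly set" where
  "apolar_ideal F = {f. diff_op f F = 0}"

definition proportional :: "bipoly \<Rightarrow> bipoly \<Rightarrow> bool" where
  "proportional l m \<longleftrightarrow> (\<exists>c::real. c \<noteq> 0 \<and> l = smult [:c:] m)"

definition almost_real_roots :: "nat \<Rightarrow> bipoly \<Rightarrow> bool" where
  "almost_real_roots r g \<longleftrightarrow> g \<in> forms r \<and> g \<noteq> 0 \<and>
     (\<exists>L. finite L \<and> r \<le> card L + 2 \<and>
        (\<forall>l\<in>L. l \<in> forms 1 \<and> l \<noteq> 0 \<and> l dvd g \<and> \<not> l^2 dvd g) \<and>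
        (\<forall>l\<in>L. \<forall>m\<in>L. l \<noteq> m \<longrightarrow> \<not> proportional l m))"

(* Meaningful for nonzero forms F only. *)
definition ar_rk :: "bipoly \<Rightarrow> nat" where
  "ar_rk F = (LEAST r. \<exists>g \<in> apolar_ideal F \<inter> forms r. almost_real_roots r g)"

(* The identification of forms of degree d with R^(d+1); Euclidean_space (d + 1) consists of the
   functions nat \<Rightarrow> real vanishing at all arguments > d. *)
definition form_coeffs :: "nat \<Rightarrow> bipoly \<Rightarrow> nat \<Rightarrow> real" where
  "form_coeffs d F = (\<lambda>i. if i \<le> d then bicoeff F i (d - i) else 0)"

lemma bij_betw_form_coeffs:
  "bij_betw (form_coeffs d) (forms d) (topspace (Euclidean_space (d + 1)))"
proof (rule bij_betwI')
  fix F G assume FG: "F \<in> forms d" "G \<in> forms d"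
  show "form_coeffs d F = form_coeffs d G \<longleftrightarrow> F = G"
  proof
    assume eq: "form_coeffs d F = form_coeffs d G"
    have "bicoeff F i j = bicoeff G i j" for i j
    proof (cases "i + j = d")
      case True
      then show ?thesis using fun_cong[OF eq, of i] by (auto simp: form_coeffs_def)
    next
      case False
      then show ?thesis using FG unfolding forms_def by (metis (mono_tags, lifting) mem_Collect_eq)
    qed
    then show "F = G" by (simp add: bicoeff_def poly_eq_iff)
  qed simp
next
  fix F assume "F \<in> forms d"
  show "form_coeffs d F \<in> topspace (Euclidean_space (d + 1))"
    by (simp add: topspace_Euclidean_space form_coeffs_def)
next
  fix c assume c: "c \<in> topspace (Euclidean_space (d + 1))"
  define F where "F = (\<Sum>i\<le>d. monom (monom (c i) i) (d - i))"
  have F: "bicoeff F i j = (if i + j = d then c i else 0)" for i j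
  proof -
    have "bicoeff F i j = (\<Sum>k\<le>d. if k = i then (if d - i = j then c i else 0) else 0)"
      unfolding bicoeff_def F_def coeff_sum by (rule sum.cong) auto
    then show ?thesis by (auto simp: sum.delta)
  qed
  have "F \<in> forms d" by (simp add: forms_def F)
  moreover have "c = form_coeffs d F"
    using c by (auto simp: form_coeffs_def F topspace_Euclidean_space)
  ultimately show "\<exists>F\<in>forms d. c = form_coeffs d F" by blast
qed

definition open_forms :: "nat \<Rightarrow> bipoly set \<Rightarrow> bool" where
  "open_forms d U \<longleftrightarrow> U \<subseteq> forms d \<and> openin (Euclidean_space (d + 1)) (form_coeffs d ` U)"

definition typical_ar_rank :: "nat \<Rightarrow> nat \<Rightarrow> bool" where
  "typical_ar_rank d r \<longleftrightarrow> (\<exists>U. open_forms d U \<and> U \<noteq> {} \<and> (\<forall>F\<in>U. F \<noteq> 0 \<and> ar_rk F = r))"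

end

(* A form F of degree d is given by its coefficients b_i, and with c_i = i! (d-i)! b_i a form g of
   degree k is apolar to F iff the Hankel equations \<Sum>_i g_i c_(i+m) = 0 hold for all m \<le> d - k.

   Put a = d + 2 - r \<ge> 4, g = (X^4 + 1)(X + 1)^(a-4), q = \<Prod>_(j<r) (X - j), and let u be an inverse
   of q modulo g. Let c_i be the coefficient of X^(a-1) in u X^i mod g. Then q is apolar to F, and
   every nonzero apolar form of degree < r is a multiple of g, so it has at least four nonreal roots.

   Both facts survive perturbation of F. The products of a quadratic form and r - 3 linear forms,
   each of norm 1, form a compact set, so that none of them becomes apolar (tube lemma). The Hankel
   equations in degree r are linearly independent, so q can be deformed continuously along with F,
   and it keeps r sign changes. *)
theory Submission
  imports Defs
begin

section \<open>Apolarity in terms of coefficients\<close>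

lemma bicoeff_smult: "bicoeff (smult [:c:] F) i j = c * bicoeff F i j"
  by (simp add: bicoeff_def)

lemma bicoeff_sum: "bicoeff (sum f A) i j = (\<Sum>x\<in>A. bicoeff (f x) i j)"
  by (simp add: bicoeff_def coeff_sum)

lemma bipoly_eq_0_iff: "F = 0 \<longleftrightarrow> (\<forall>i j. bicoeff F i j = 0)"
  by (auto simp: bicoeff_def poly_eq_iff)

lemma bicoeff_diff_x: "bicoeff (diff_x F) i j = real (Suc i) * bicoeff F (Suc i) j"
  by (simp add: bicoeff_def diff_x_def coeff_map_poly coeff_pderiv)

lemma bicoeff_diff_y: "bicoeff (diff_y F) i j = real (Suc j) * bicoeff F i (Suc j)"
proof -
  have "coeff (of_nat n * p) i = real n * coeff p i" for n and p :: "real poly"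
    by (simp add: of_nat_poly)
  from this[of "Suc j"] show ?thesis
    by (simp only: bicoeff_def diff_y_def coeff_pderiv)
qed

text \<open>Weighting by factorials on both sides avoids falling factorials: each derivative
  contributes exactly the factor that turns \<open>fact i\<close> into
  \<open>fact (Suc i)\<close>.\<close>

lemma bicoeff_diff_x_pow:
  "fact i * bicoeff ((diff_x ^^ n) F) i j = fact (i + n) * bicoeff F (i + n) j"
proof (induction n arbitrary: i)
  case (Suc n)
  have "fact i * bicoeff ((diff_x ^^ Suc n) F) i j
      = fact (Suc i) * bicoeff ((diff_x ^^ n) F) (Suc i) j"
    by (simp add: bicoeff_diff_x algebra_simps)
  also have "\<dots> = fact (Suc i + n) * bicoeff F (Suc i + n) j"
    by (rule Suc.IH)
  finally show ?case by simp
qed simp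

lemma bicoeff_diff_y_pow:
  "fact j * bicoeff ((diff_y ^^ n) F) i j = fact (j + n) * bicoeff F i (j + n)"
proof (induction n arbitrary: j)
  case (Suc n)
  have "fact j * bicoeff ((diff_y ^^ Suc n) F) i j
      = fact (Suc j) * bicoeff ((diff_y ^^ n) F) i (Suc j)"
    by (simp add: bicoeff_diff_y algebra_simps)
  also have "\<dots> = fact (Suc j + n) * bicoeff F i (Suc j + n)"
    by (rule Suc.IH)
  finally show ?case by simp
qed simp

lemma bicoeff_eq_0: "degree F < j \<or> degree (coeff F j) < i \<Longrightarrow> bicoeff F i j = 0"
  by (auto simp: bicoeff_def coeff_eq_0)

text \<open>Rids \<open>diff_op\<close> of summation ranges that depend on the degrees of g. All
  coefficients off the antidiagonal i + j = k vanish, so both ranges can be replaced by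
  \<open>{..k}\<close>, and then one j is left for each i.\<close>

lemma sum_form:
  assumes "g \<in> forms k"
  shows "(\<Sum>j\<le>degree g. \<Sum>i\<le>degree (coeff g j). bicoeff g i j * h i j)
       = (\<Sum>i\<le>k. bicoeff g i (k - i) * h i (k - i))"
proof -
  have z: "bicoeff g i j = 0" if "i + j \<noteq> k" for i j
    using assms that by (auto simp: forms_def)
  have inner: "(\<Sum>i\<le>degree (coeff g j). bicoeff g i j * h i j)
      = (\<Sum>i\<le>k. bicoeff g i j * h i j)" for j
    by (rule sum.mono_neutral_cong) (auto simp: z bicoeff_eq_0)
  have "(\<Sum>j\<le>degree g. \<Sum>i\<le>k. bicoeff g i j * h i j)
      = (\<Sum>j\<le>k. \<Sum>i\<le>k. bicoeff g i j * h i j)"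
    by (rule sum.mono_neutral_cong) (auto simp: z bicoeff_eq_0)
  also have "\<dots> = (\<Sum>i\<le>k. \<Sum>j\<le>k. bicoeff g i j * h i j)"
    by (rule sum.swap)
  also have "\<dots> = (\<Sum>i\<le>k. bicoeff g i (k - i) * h i (k - i))"
  proof (rule sum.cong[OF refl])
    fix i assume "i \<in> {..k}"
    then have "(\<Sum>j\<in>{k - i}. bicoeff g i j * h i j) = (\<Sum>j\<le>k. bicoeff g i j * h i j)"
      by (intro sum.mono_neutral_left) (auto simp: z)
    then show "(\<Sum>j\<le>k. bicoeff g i j * h i j) = bicoeff g i (k - i) * h i (k - i)"
      by simp
  qed
  finally show ?thesis by (simp add: inner)
qed

(* The factorials turn the action of differential operators into the Hankel pairing of the
   coefficient sequences p (of the operator) and b (of the form of degree d). *)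
definition hankel :: "nat \<Rightarrow> nat \<Rightarrow> nat \<Rightarrow> (nat \<Rightarrow> real) \<Rightarrow> (nat \<Rightarrow> real) \<Rightarrow> real" where
  "hankel d k m b p = (\<Sum>i\<le>k. p i * (fact (i + m) * fact (d - (i + m)) * b (i + m)))"

lemma bicoeff_diff_op:
  assumes g: "g \<in> forms k"
  shows "fact s * fact t * bicoeff (diff_op g F) s t
       = (\<Sum>i\<le>k. bicoeff g i (k - i) *
           (fact (s + i) * fact (t + (k - i)) * bicoeff F (s + i) (t + (k - i))))"
proof -
  have "fact s * fact t * bicoeff (diff_op g F) s t
      = (\<Sum>j\<le>degree g. \<Sum>i\<le>degree (coeff g j). bicoeff g i j *
           (fact t * (fact s * bicoeff ((diff_x ^^ i) ((diff_y ^^ j) F)) s t)))"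
    by (simp add: diff_op_def bicoeff_sum bicoeff_smult sum_distrib_left algebra_simps)
  also have "\<dots> = (\<Sum>i\<le>k. bicoeff g i (k - i) *
           (fact t * (fact s * bicoeff ((diff_x ^^ i) ((diff_y ^^ (k - i)) F)) s t)))"
    by (rule sum_form[OF g])
  also have "\<dots> = (\<Sum>i\<le>k. bicoeff g i (k - i) *
           (fact (s + i) * (fact t * bicoeff ((diff_y ^^ (k - i)) F) (s + i) t)))"
    by (simp add: bicoeff_diff_x_pow algebra_simps)
  finally show ?thesis
    by (simp only: bicoeff_diff_y_pow mult.assoc)
qed

text \<open>The derivative \<open>diff_op g F\<close> is a form of degree d - k. Its coefficient at
  x^m y^(d-k-m) is the m-th Hankel pairing up to nonzero factorials, and the other coefficients
  vanish because F is homogeneous.\<close>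

lemma apolar_iff_hankel:
  assumes g: "g \<in> forms k" and F: "F \<in> forms d" and "k \<le> d"
  shows "g \<in> apolar_ideal F \<longleftrightarrow>
    (\<forall>m\<le>d - k. hankel d k m (form_coeffs d F) (\<lambda>i. bicoeff g i (k - i)) = 0)"
proof -
  have zF: "bicoeff F i j = 0" if "i + j \<noteq> d" for i j
    using F that by (auto simp: forms_def)
  have off: "bicoeff (diff_op g F) s t = 0" if "s + t + k \<noteq> d" for s t
  proof -
    have "fact s * fact t * bicoeff (diff_op g F) s t = 0"
      unfolding bicoeff_diff_op[OF g] using that by (intro sum.neutral) (auto simp: zF)
    then show ?thesis by simp
  qed
  have on: "fact s * fact (d - k - s) * bicoeff (diff_op g F) s (d - k - s)
      = hankel d k s (form_coeffs d F) (\<lambda>i. bicoeff g i (k - i))" if "s \<le> d - k" for s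
    unfolding bicoeff_diff_op[OF g] hankel_def
  proof (rule sum.cong[OF refl])
    fix i assume "i \<in> {..k}"
    then have "d - k - s + (k - i) = d - (i + s)" "i + s \<le> d"
      using that \<open>k \<le> d\<close> by auto
    then show "bicoeff g i (k - i) * (fact (s + i) * fact (d - k - s + (k - i)) *
          bicoeff F (s + i) (d - k - s + (k - i)))
        = bicoeff g i (k - i) * (fact (i + s) * fact (d - (i + s)) * form_coeffs d F (i + s))"
      by (simp add: form_coeffs_def add.commute)
  qed
  have "g \<in> apolar_ideal F \<longleftrightarrow> (\<forall>s t. bicoeff (diff_op g F) s t = 0)"
    by (simp add: apolar_ideal_def bipoly_eq_0_iff)
  also have "\<dots> \<longleftrightarrow> (\<forall>s\<le>d - k. bicoeff (diff_op g F) s (d - k - s) = 0)"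
  proof (intro iffI allI impI)
    fix s t assume *: "\<forall>s\<le>d - k. bicoeff (diff_op g F) s (d - k - s) = 0"
    show "bicoeff (diff_op g F) s t = 0"
    proof (cases "s + t + k = d")
      case True
      then have "s \<le> d - k" "t = d - k - s" by auto
      with * show ?thesis by blast
    qed (rule off)
  qed simp
  also have "\<dots> \<longleftrightarrow>
      (\<forall>m\<le>d - k. hankel d k m (form_coeffs d F) (\<lambda>i. bicoeff g i (k - i)) = 0)"
  proof (intro all_cong)
    fix s assume "s \<le> d - k"
    then show "bicoeff (diff_op g F) s (d - k - s) = 0 \<longleftrightarrow>
        hankel d k s (form_coeffs d F) (\<lambda>i. bicoeff g i (k - i)) = 0"
      by (simp flip: on)
  qed
  finally show ?thesis .
qed

section \<open>Passing between binary forms and polynomials in one variable\<close>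

text \<open>The outer variable is y, so \<open>poly g 1\<close> is g(x, 1), a polynomial in x. For a
  form, each power of x receives at most one coefficient, hence nothing is merged.\<close>

lemma coeff_dehomogenize:
  assumes "g \<in> forms k"
  shows "coeff (poly g 1) i = (if i \<le> k then bicoeff g i (k - i) else 0)"
proof -
  have z: "bicoeff g i j = 0" if "i + j \<noteq> k" for i j
    using assms that by (auto simp: forms_def)
  have "coeff (poly g 1) i = (\<Sum>j\<le>degree g. bicoeff g i j)"
    by (simp add: poly_altdef coeff_sum bicoeff_def)
  also have "\<dots> = (\<Sum>j\<in>(if i \<le> k then {k - i} else {}). bicoeff g i j)"
    by (rule sum.mono_neutral_cong) (auto simp: z bicoeff_eq_0 split: if_splits)
  finally show ?thesis by simp
qed

lemma degree_dehomogenize: "g \<in> forms k \<Longrightarrow> degree (poly g 1) \<le> k"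
  by (rule degree_le) (simp add: coeff_dehomogenize)

lemma dehomogenize_eq_0_iff:
  assumes "g \<in> forms k"
  shows "poly g 1 = 0 \<longleftrightarrow> g = 0"
proof
  assume *: "poly g 1 = 0"
  have "bicoeff g i j = 0" for i j
  proof (cases "i + j = k")
    case True
    with * coeff_dehomogenize[OF assms, of i] show ?thesis by auto
  next
    case False
    with assms show ?thesis by (auto simp: forms_def)
  qed
  then show "g = 0" by (simp add: bipoly_eq_0_iff)
qed simp

text \<open>For p of degree at most n this is y^n p(x/y); a degree below n shows up as a power of y,
  that is, as roots at infinity. Coefficients beyond n are cut off.\<close>

definition homogenize :: "nat \<Rightarrow> real poly \<Rightarrow> bipoly" where
  "homogenize n p = (\<Sum>i\<le>n. monom (monom (coeff p i) i) (n - i))"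

lemma bicoeff_homogenize:
  "bicoeff (homogenize n p) i j = (if i + j = n then coeff p i else 0)"
proof -
  have "bicoeff (homogenize n p) i j
      = (\<Sum>k\<le>n. if k = i then (if n - i = j then coeff p i else 0) else 0)"
    unfolding bicoeff_def homogenize_def coeff_sum by (rule sum.cong) auto
  then show ?thesis by (auto simp: sum.delta)
qed

lemma homogenize_in_forms: "homogenize n p \<in> forms n"
  by (simp add: forms_def bicoeff_homogenize)

lemma dehomogenize_homogenize:
  assumes "degree p \<le> n"
  shows "poly (homogenize n p) 1 = p"
  using assms
  by (auto simp: poly_eq_iff coeff_dehomogenize[OF homogenize_in_forms] bicoeff_homogenize
      intro: coeff_eq_0)

lemma homogenize_linear_mult:
  assumes "degree s \<le> n"
  shows "homogenize (Suc n) ([:-t, 1:] * s) = homogenize 1 [:-t, 1:] * homogenize n s"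
proof -
  \<comment> \<open>The form x - t y, written by powers of y.\<close>
  have lin: "homogenize 1 [:-t, 1:] = [:[:0, 1:], [:-t:]:]"
  proof -
    have "bicoeff (homogenize 1 [:-t, 1:]) i j = bicoeff [:[:0, 1:], [:-t:]:] i j" for i j
      unfolding bicoeff_homogenize by (auto simp: bicoeff_def coeff_pCons split: nat.splits)
    then show ?thesis by (simp add: bicoeff_def poly_eq_iff)
  qed
  have "bicoeff (homogenize (Suc n) ([:-t, 1:] * s)) i j
      = bicoeff ([:[:0, 1:], [:-t:]:] * homogenize n s) i j" for i j
  proof -
    have "bicoeff ([:[:0, 1:], [:-t:]:] * G) i j
        = (case i of 0 \<Rightarrow> 0 | Suc i' \<Rightarrow> bicoeff G i' j)
        + (case j of 0 \<Rightarrow> 0 | Suc j' \<Rightarrow> - t * bicoeff G i j')" for G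
      by (auto simp: bicoeff_def coeff_pCons split: nat.splits)
    then show ?thesis
      using assms
      by (cases i; cases j) (simp_all add: bicoeff_homogenize coeff_eq_0)
  qed
  then show ?thesis unfolding lin poly_eq_iff bicoeff_def by blast
qed

section \<open>Almost real roots in terms of one variable\<close>

text \<open>Every root t yields the factor x - t y. It is simple: if its square divided, the
  cofactor would have degree at most r - 2 but still vanish on the r - 1 other points of T.\<close>

lemma almost_real_roots_homogenize:
  assumes deg: "degree p \<le> r" and "p \<noteq> 0"
    and T: "finite T" "card T = r" "\<And>t. t \<in> T \<Longrightarrow> poly p t = 0"
  shows "almost_real_roots r (homogenize r p)"
proof -
  let ?l = "\<lambda>t. homogenize 1 [:-t, 1::real:]"
  have dl: "poly (?l t) 1 = [:-t, 1:]" for t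
    by (rule dehomogenize_homogenize) simp
  have "\<not> proportional (?l s) (?l t)" if "?l s \<noteq> ?l t" for s t
  proof
    assume "proportional (?l s) (?l t)"
    have "s \<noteq> t" using that by auto
    from \<open>proportional (?l s) (?l t)\<close>
    obtain c where c: "?l s = smult [:c:] (?l t)" by (auto simp: proportional_def)
    have "bicoeff (?l s) i j = c * bicoeff (?l t) i j" for i j
      unfolding c bicoeff_smult ..
    \<comment> \<open>The coefficients of x force c = 1, and then those of y force s = t.\<close>
    from this[of 0 1] this[of 1 0] \<open>s \<noteq> t\<close> show False by (simp add: bicoeff_homogenize)
  qed
  moreover have inj: "inj_on ?l T"
  proof (rule inj_onI)
    fix s t assume "?l s = ?l t"
    then have "poly (?l s) 1 = poly (?l t) 1" by (rule arg_cong)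
    then show "s = t" unfolding dl by simp
  qed
  moreover have "?l t \<noteq> 0" for t
    using dl[of t] by force
  moreover have "?l t dvd homogenize r p" if t: "t \<in> T" for t
  proof -
    obtain s where s: "p = [:-t, 1:] * s" using T(3)[OF t] by (auto simp: poly_eq_0_iff_dvd)
    with \<open>p \<noteq> 0\<close> have "s \<noteq> 0" by auto
    then have ds: "degree p = Suc (degree s)" unfolding s by (subst degree_mult_eq) auto
    then obtain n where n: "r = Suc n" "degree s \<le> n" using deg by (cases r) auto
    have "homogenize r p = ?l t * homogenize n s"
      unfolding n s by (rule homogenize_linear_mult[OF n(2)])
    then show ?thesis by simp
  qed
  moreover have "\<not> (?l t)\<^sup>2 dvd homogenize r p" if t: "t \<in> T" for t
  proof
    assume "(?l t)\<^sup>2 dvd homogenize r p"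
    then obtain h where "homogenize r p = (?l t)\<^sup>2 * h" by (meson dvdE)
    then have "poly (homogenize r p) 1 = (poly (?l t) 1)\<^sup>2 * poly h 1" by simp
    then have s: "p = [:-t, 1:]\<^sup>2 * poly h 1"
      unfolding dl dehomogenize_homogenize[OF deg] .
    with \<open>p \<noteq> 0\<close> have h0: "poly h 1 \<noteq> 0" by auto
    then have ds: "degree p = 2 + degree (poly h 1)"
      by (subst s, subst degree_mult_eq) (auto simp: degree_power_eq)
    have "poly p x = (x - t)\<^sup>2 * poly (poly h 1) x" for x
      by (subst s) simp
    then have "poly (poly h 1) x = 0" if "x \<in> T - {t}" for x
      using T(3)[of x] that by auto
    then have "card (T - {t}) \<le> card {x. poly (poly h 1) x = 0}"
      by (intro card_mono poly_roots_finite h0) auto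
    also have "\<dots> \<le> degree (poly h 1)" by (rule card_poly_roots_bound[OF h0])
    finally show False using T t ds deg by simp
  qed
  moreover have "homogenize r p \<noteq> 0"
    using dehomogenize_homogenize[OF deg] \<open>p \<noteq> 0\<close> by auto
  ultimately show ?thesis
    unfolding almost_real_roots_def
    using T by (intro conjI exI[of _ "?l ` T"]) (auto simp: homogenize_in_forms card_image)
qed

(* A factor of g proportional to y is a root at infinity of the dehomogenization: it lowers the
   degree instead of contributing to the set of roots. *)
lemma almost_real_roots_dehomogenize:
  assumes "almost_real_roots k g"
  shows "degree (poly g 1) \<le> card {t. poly (poly g 1) t = 0} + 2"
proof -
  let ?p = "poly g 1"
  from assms obtain L where g: "g \<in> forms k" "g \<noteq> 0" and L: "finite L" "k \<le> card L + 2"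
    and lin: "\<And>l. l \<in> L \<Longrightarrow> l \<in> forms 1 \<and> l \<noteq> 0 \<and> l dvd g"
    and np: "\<And>l m. l \<in> L \<Longrightarrow> m \<in> L \<Longrightarrow> l \<noteq> m \<Longrightarrow> \<not> proportional l m"
    unfolding almost_real_roots_def by blast
  have p0: "?p \<noteq> 0" using g dehomogenize_eq_0_iff by blast
  \<comment> \<open>So l is \<open>\<alpha> l\<close> x + \<open>\<beta> l\<close> y.\<close>
  define \<alpha> \<beta> where "\<alpha> l = bicoeff l 1 0" and "\<beta> l = bicoeff l 0 1" for l
  have off: "bicoeff l i j = 0" if "l \<in> L" "i + j \<noteq> 1" for l i j
    using lin[OF that(1)] that(2) unfolding forms_def by fastforce
  have propI: "proportional l m" if "l \<in> L" "m \<in> L" "c \<noteq> 0" "\<alpha> l = c * \<alpha> m" "\<beta> l = c * \<beta> m" for l m c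
  proof -
    have "bicoeff l i j = bicoeff (smult [:c:] m) i j" for i j
    proof (cases "i + j = 1")
      case True
      then have "i = 1 \<and> j = 0 \<or> i = 0 \<and> j = 1" by linarith
      with that show ?thesis by (auto simp: bicoeff_smult \<alpha>_def \<beta>_def)
    next
      case False
      with that(1,2) show ?thesis by (simp add: bicoeff_smult off)
    qed
    then have "l = smult [:c:] m" by (simp add: bicoeff_def poly_eq_iff)
    with \<open>c \<noteq> 0\<close> show ?thesis by (auto simp: proportional_def)
  qed
  have \<beta>0: "\<beta> l \<noteq> 0" if "l \<in> L" "\<alpha> l = 0" for l
  proof
    assume "\<beta> l = 0"
    have "bicoeff l i j = 0" for i j
    proof (cases "i + j = 1")
      case True
      then have "i = 1 \<and> j = 0 \<or> i = 0 \<and> j = 1" by linarith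
      with that \<open>\<beta> l = 0\<close> show ?thesis by (auto simp: \<alpha>_def \<beta>_def)
    next
      case False
      with that(1) show ?thesis by (simp add: off)
    qed
    with lin[OF that(1)] show False by (simp add: bipoly_eq_0_iff)
  qed
  \<comment> \<open>\<open>L0\<close> holds the factors with a finite root, namely
    \<open>- \<beta> l / \<alpha> l\<close>; \<open>L1\<close> holds those proportional to
    y.\<close>
  define L0 L1 where "L0 = {l \<in> L. \<alpha> l \<noteq> 0}" and "L1 = {l \<in> L. \<alpha> l = 0}"
  have "inj_on (\<lambda>l. - \<beta> l / \<alpha> l) L0"
  proof (rule inj_onI, rule ccontr)
    fix l m assume *: "l \<in> L0" "m \<in> L0" "- \<beta> l / \<alpha> l = - \<beta> m / \<alpha> m" "l \<noteq> m"
    then have L: "l \<in> L" "m \<in> L" and \<alpha>: "\<alpha> l \<noteq> 0" "\<alpha> m \<noteq> 0" by (auto simp: L0_def)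
    have "\<beta> l = \<alpha> l / \<alpha> m * \<beta> m" using *(3) \<alpha> by (simp add: field_simps)
    then have "proportional l m" using L \<alpha> by (intro propI[of l m "\<alpha> l / \<alpha> m"]) auto
    with np[OF L *(4)] show False by blast
  qed
  moreover have "poly ?p (- \<beta> l / \<alpha> l) = 0" if "l \<in> L0" for l
  proof -
    have l: "l \<in> L" "\<alpha> l \<noteq> 0" using that by (auto simp: L0_def)
    have "l \<in> forms 1" using lin[OF l(1)] by blast
    then have "coeff (poly l 1) i = coeff [:\<beta> l, \<alpha> l:] i" for i
      by (cases i) (auto simp: coeff_dehomogenize[of l 1] \<alpha>_def \<beta>_def coeff_pCons split: nat.splits)
    then have "poly l 1 = [:\<beta> l, \<alpha> l:]" by (simp add: poly_eq_iff)
    moreover obtain h where "g = l * h" using lin[OF l(1)] by (meson dvdE)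
    ultimately have "?p = [:\<beta> l, \<alpha> l:] * poly h 1" by simp
    then show ?thesis using l(2) by simp
  qed
  ultimately have c0: "card L0 \<le> card {t. poly ?p t = 0}"
    by (intro card_inj_on_le[where f = "\<lambda>l. - \<beta> l / \<alpha> l"] poly_roots_finite p0 image_subsetI CollectI)
  have c1: "degree ?p + card L1 \<le> k"
  proof (cases "L1 = {}")
    case True
    then show ?thesis using degree_dehomogenize[OF g(1)] by simp
  next
    case False
    then obtain l where l: "l \<in> L1" by auto
    \<comment> \<open>Two members of \<open>L1\<close> are both multiples of y, hence proportional
      to each other.\<close>
    have "m = l" if "m \<in> L1" for m
    proof (rule ccontr)
      assume "m \<noteq> l"
      have "m \<in> L" "l \<in> L" "\<alpha> m = 0" "\<alpha> l = 0" using that l by (auto simp: L1_def)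
      moreover from this have "proportional m l"
        using \<beta>0 by (intro propI[of m l "\<beta> m / \<beta> l"]) auto
      ultimately show False using np \<open>m \<noteq> l\<close> by blast
    qed
    with l have "L1 = {l}" by blast
    moreover have "degree ?p < k"
    proof -
      have l': "l \<in> forms 1" "l dvd g" "\<alpha> l = 0" using l lin by (auto simp: L1_def)
      then obtain h where "g = l * h" by (meson dvdE)
      moreover have "coeff (coeff l 0) i = 0" for i
        using l'(3) off[of l i 0] l by (cases "i = 1") (auto simp: \<alpha>_def bicoeff_def L1_def)
      \<comment> \<open>Thus y divides l and therefore g, so g has no term x^k and the
        dehomogenization loses a degree.\<close>
      then have "coeff l 0 = 0" by (simp add: poly_eq_iff)
      ultimately have "bicoeff g k 0 = 0" by (simp add: bicoeff_def coeff_mult_0)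
      then have ck: "coeff ?p k = 0" by (simp add: coeff_dehomogenize[OF g(1)])
      with p0 have "degree ?p \<noteq> k" by (metis leading_coeff_0_iff)
      with degree_dehomogenize[OF g(1)] show ?thesis by simp
    qed
    ultimately show ?thesis by simp
  qed
  have "L = L0 \<union> L1" "L0 \<inter> L1 = {}" by (auto simp: L0_def L1_def)
  with L(1) have "card L = card L0 + card L1" by (simp add: card_Un_disjoint)
  with c0 c1 L(2) show ?thesis by linarith
qed

section \<open>Residues modulo a real polynomial\<close>

text \<open>A Bezout argument: p minus a multiple of X - t is the nonzero constant p(t). Multiplying
  this identity by s writes a nonzero multiple of s as a combination of p and (X - t) s.\<close>

lemma dvd_linear_mult_cancel:
  fixes p s :: "real poly"
  assumes nz: "poly p t \<noteq> 0" and dvd: "p dvd [:-t, 1:] * s"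
  shows "p dvd s"
proof -
  have "[:-t, 1:] dvd p - [:poly p t:]"
    by (simp add: poly_eq_0_iff_dvd[symmetric])
  then obtain k where k: "p - [:poly p t:] = [:-t, 1:] * k" by auto
  have "smult (poly p t) s = p * s - (p - [:poly p t:]) * s"
    by (simp add: algebra_simps)
  also have "\<dots> = p * s - k * ([:-t, 1:] * s)"
    unfolding k by (simp only: mult_ac)
  also have "p dvd \<dots>" by (rule dvd_diff[OF dvd_triv_left dvd_mult[OF dvd]])
  finally show ?thesis using nz by (simp add: dvd_smult_iff)
qed

text \<open>Each factor X - t_i is a unit modulo p because p does not vanish at t_i; the inverses
  are multiplied up by induction.\<close>

lemma ex_inverse_mod_prod_linear:
  fixes p :: "real poly"
  assumes "finite I" and "\<And>i. i \<in> I \<Longrightarrow> poly p (t i) \<noteq> 0"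
  shows "\<exists>u. p dvd u * (\<Prod>i\<in>I. [:- t i, 1:]) - 1"
  using assms
proof (induction I)
  case (insert i I)
  let ?l = "[:- t i, 1:]" and ?q = "\<Prod>i\<in>I. [:- t i, 1:]" and ?c = "poly p (t i)"
  obtain u where u: "p dvd u * ?q - 1" using insert by auto
  have c: "?c \<noteq> 0" using insert.prems by auto
  have "?l dvd p - [:?c:]" by (simp add: poly_eq_0_iff_dvd[symmetric])
  then obtain k where k: "p - [:?c:] = ?l * k" by auto
  \<comment> \<open>Modulo p, the product of \<open>?l\<close> and k is \<open>- ?c\<close>, so
    \<open>smult (- 1 / ?c) k\<close> inverts \<open>?l\<close>.\<close>
  have "smult (- 1 / ?c) k * ?l - 1 = smult (- 1 / ?c) (p - [:?c:]) - 1"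
    unfolding k by (simp only: mult_smult_left mult.commute[of k])
  also have "\<dots> = smult (- 1 / ?c) p"
    using c by (simp add: smult_diff_right one_pCons)
  finally have v: "smult (- 1 / ?c) k * ?l - 1 = smult (- 1 / ?c) p" .
  have "u * smult (- 1 / ?c) k * (?l * ?q) - 1
      = (u * ?q) * (smult (- 1 / ?c) k * ?l - 1) + (u * ?q - 1)"
    by (simp only: algebra_simps)
  also have "p dvd \<dots>"
    unfolding v using u by (intro dvd_add dvd_mult dvd_smult) auto
  finally show ?case using insert.hyps by (auto intro!: exI[of _ "u * smult (- 1 / ?c) k"])
qed (auto intro!: exI[of _ 1])

lemma mod_sum_poly: "(\<Sum>i\<in>A. f i) mod g = (\<Sum>i\<in>A. f i mod g)"
  for g :: "real poly"
  by (induction A rule: infinite_finite_induct) (auto simp: poly_mod_add_left)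

lemma poly_mod_mult_one:
  fixes g u :: "real poly"
  assumes "g dvd u - 1"
  shows "(u * p) mod g = p mod g"
proof -
  have "g dvd (u - 1) * p" using assms by simp
  then have "g dvd u * p - p" by (simp add: algebra_simps)
  then show ?thesis by (rule mod_eq_dvd_iff[THEN iffD2])
qed

text \<open>Taking one coefficient of a residue is linear. The left side has the shape of a Hankel
  pairing, so that Hankel equations become statements about residues modulo g.\<close>

lemma sum_coeff_residue:
  fixes g u p :: "real poly"
  assumes "degree p \<le> n"
  shows "(\<Sum>i\<le>n. coeff p i * coeff ((u * monom 1 (i + m)) mod g) e)
       = coeff ((u * p * monom 1 m) mod g) e"
proof -
  have "p = (\<Sum>i\<le>n. monom (coeff p i) i)" using assms by (rule poly_as_sum_of_monoms'[symmetric])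
  then have "u * p * monom 1 m = u * (\<Sum>i\<le>n. monom (coeff p i) i) * monom 1 m" by simp
  also have "\<dots> = (\<Sum>i\<le>n. smult (coeff p i) (u * monom 1 (i + m)))"
    unfolding sum_distrib_left sum_distrib_right
    by (rule sum.cong) (auto simp: mult_monom smult_monom mult.assoc simp flip: mult_smult_right)
  finally show ?thesis by (simp add: mod_sum_poly mod_smult_left coeff_sum)
qed

(* The functional "coefficient of X^(a-1)" makes R[X]/(g) a Gorenstein algebra. *)
lemma dvd_if_top_coeffs_0:
  fixes g p :: "real poly"
  assumes a: "degree g = a" "0 < a"
    and top: "\<And>m. m < a \<Longrightarrow> coeff ((p * monom 1 m) mod g) (a - 1) = 0"
  shows "g dvd p"
proof (rule ccontr)
  assume "\<not> g dvd p"
  define q where "q = p mod g"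
  have q0: "q \<noteq> 0" using \<open>\<not> g dvd p\<close> by (simp add: q_def dvd_eq_mod_eq_0)
  have dq: "degree q < a"
    unfolding q_def a(1)[symmetric] using a q0 by (intro degree_mod_less') (auto simp: q_def)
  \<comment> \<open>This shift moves the leading term of the residue q to X^(a-1), the highest
    position that needs no reduction modulo g.\<close>
  define m where "m = a - 1 - degree q"
  have "degree (q * monom 1 m) = degree q + m"
    using q0 by (simp add: degree_mult_eq degree_monom_eq)
  then have "(q * monom 1 m) mod g = q * monom 1 m"
    using dq a by (intro mod_poly_less) (simp add: m_def)
  then have "(p * monom 1 m) mod g = q * monom 1 m"
    unfolding q_def by (simp add: mod_mult_left_eq)
  moreover have "coeff (q * monom 1 m) (degree q + m) = lead_coeff q"
    by (simp add: coeff_monom_mult mult.commute[of q])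
  moreover have "degree q + m = a - 1" "m < a" using dq by (auto simp: m_def)
  ultimately have "lead_coeff q = 0" using top[of m] by simp
  with q0 show False by simp
qed

(* Coefficient sequences of products of a quadratic and n linear polynomials, normalized so that
   they form a compact set; leading coefficients may vanish, which means roots at infinity. *)
fun almost_real_rooted_coeffs :: "nat \<Rightarrow> (nat \<Rightarrow> real) set" where
  "almost_real_rooted_coeffs 0 =
     (\<lambda>(x, y, z) i. if i = 0 then x else if i = 1 then y else if i = 2 then z else 0) ` sphere 0 1"
| "almost_real_rooted_coeffs (Suc n) =
     (\<lambda>((x, y), f) i. x * f i + y * (case i of 0 \<Rightarrow> 0 | Suc j \<Rightarrow> f j)) `
       (sphere 0 1 \<times> almost_real_rooted_coeffs n)"

declare almost_real_rooted_coeffs.simps [simp del]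

section \<open>The compact set of normalized almost real-rooted polynomials\<close>

text \<open>Sequences carry the product topology, so continuity of the multiplication maps is
  checked coordinatewise; spheres in finite dimension are compact.\<close>

lemma compact_almost_real_rooted_coeffs: "compact (almost_real_rooted_coeffs n)"
proof (induction n)
  case 0
  have "continuous_on (sphere 0 1) (\<lambda>(x :: real, y :: real, z :: real) i.
      if i = (0 :: nat) then x else if i = 1 then y else if i = 2 then z else 0)"
  proof (rule continuous_on_coordinatewise_then_product, goal_cases)
    case (1 i)
    show ?case
      by (cases "i = 0"; cases "i = 1"; cases "i = 2")
         (auto simp: case_prod_beta intro!: continuous_intros)
  qed
  then show ?case
    unfolding almost_real_rooted_coeffs.simps by (intro compact_continuous_image compact_sphere)
next
  case (Suc n)
  have "continuous_on (sphere 0 1 \<times> almost_real_rooted_coeffs n)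
    (\<lambda>((x, y), f) i. x * f i + y * (case i of 0 \<Rightarrow> 0 | Suc j \<Rightarrow> f j))"
  proof (rule continuous_on_coordinatewise_then_product, goal_cases)
    case (1 i)
    have c: "continuous_on S (\<lambda>z. snd z j)" for S :: "((real \<times> real) \<times> (nat \<Rightarrow> real)) set" and j
      by (rule continuous_on_product_then_coordinatewise) (intro continuous_intros)
    show ?case
      by (cases i) (auto simp: case_prod_beta intro!: continuous_intros c)
  qed
  with Suc show ?case
    unfolding almost_real_rooted_coeffs.simps by (intro compact_continuous_image compact_Times compact_sphere)
qed

lemma coeff_linear_mult:
  "coeff ([:x, y:] * p) = (\<lambda>i. x * coeff p i + y * (case i of 0 \<Rightarrow> 0 | Suc j \<Rightarrow> coeff p j))"
  for x y :: real
  by (auto simp: fun_eq_iff coeff_pCons split: nat.splits)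

lemma coeff_quadratic:
  "coeff [:x, y, z:] = (\<lambda>i. if i = 0 then x else if i = 1 then y else if i = 2 then z else 0)"
  for x y z :: real
  by (auto simp: fun_eq_iff coeff_pCons split: nat.splits)

text \<open>A polynomial P without real roots is coprime to every real linear factor. If P divided
  the product, the linear factors could be cancelled one by one, and P would divide the nonzero
  factor of degree at most 2.\<close>

lemma almost_real_rooted_coeffsE:
  assumes "f \<in> almost_real_rooted_coeffs n" and P: "2 < degree P" "\<And>t. poly P t \<noteq> 0"
  obtains p where "f = coeff p" "degree p \<le> n + 2" "\<not> P dvd p"
proof -
  have "\<exists>p. f = coeff p \<and> degree p \<le> n + 2 \<and> \<not> P dvd p"
    using assms(1)
  proof (induction n arbitrary: f)
    case 0
    then obtain x y z where f: "f = coeff [:x, y, z:]" and n: "norm (x, y, z) = 1"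
      by (auto simp: coeff_quadratic almost_real_rooted_coeffs.simps)
    have "[:x, y, z:] \<noteq> 0" using n by (auto simp: norm_Pair)
    moreover have d: "degree [:x, y, z:] \<le> 2" by simp
    ultimately have "\<not> P dvd [:x, y, z:]" using P(1) dvd_imp_degree_le by fastforce
    with d f show ?case by auto
  next
    case (Suc n)
    then obtain x y h where h: "h \<in> almost_real_rooted_coeffs n" and n: "norm (x, y) = 1"
      and f: "f = (\<lambda>i. x * h i + y * (case i of 0 \<Rightarrow> 0 | Suc j \<Rightarrow> h j))"
      by (auto simp: almost_real_rooted_coeffs.simps)
    obtain p where p: "h = coeff p" "degree p \<le> n + 2" "\<not> P dvd p" using Suc.IH[OF h] by blast
    have "\<not> P dvd [:x, y:] * p"
    proof (cases "y = 0")
      \<comment> \<open>The factor is a nonzero constant, that is, a root at infinity.\<close>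
      case True
      with n have "x \<noteq> 0" by (auto simp: norm_Pair)
      with True p(3) show ?thesis by (simp add: dvd_smult_iff)
    next
      case False
      have "[:x, y:] = smult y [:- (- x / y), 1:]" using False by simp
      then have "[:x, y:] * p = smult y ([:- (- x / y), 1:] * p)" by (simp only: mult_smult_left)
      then have "P dvd [:x, y:] * p \<longleftrightarrow> P dvd [:- (- x / y), 1:] * p"
        using False by (simp only: dvd_smult_iff simp_thms)
      then show ?thesis using dvd_linear_mult_cancel[OF P(2)] p(3) by blast
    qed
    moreover have "degree ([:x, y:] * p) \<le> Suc n + 2"
      using degree_mult_le[of "[:x, y:]" p] p(2) by (auto split: if_splits)
    ultimately show ?case
      using f p(1) by (intro exI[of _ "[:x, y:] * p"]) (simp only: coeff_linear_mult simp_thms)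
  qed
  with that show thesis by blast
qed

lemma almost_real_rooted_coeffs_mult:
  assumes p: "coeff p \<in> almost_real_rooted_coeffs n" and l: "[:x, y:] \<noteq> 0"
  shows "\<exists>s. s \<noteq> 0 \<and> coeff (smult s ([:x, y:] * p)) \<in> almost_real_rooted_coeffs (Suc n)"
proof -
  define s where "s = 1 / norm (x, y)"
  have "(x, y) \<noteq> 0" using l by (auto simp: zero_prod_def)
  then have n: "norm (x, y) \<noteq> 0" by simp
  have "norm (s *\<^sub>R (x, y)) = 1" unfolding norm_scaleR s_def using n by simp
  then have "(s * x, s * y) \<in> sphere 0 1" by simp
  moreover have "smult s ([:x, y:] * p) = [:s * x, s * y:] * p" by (simp add: smult_add_right)
  ultimately have "coeff (smult s ([:x, y:] * p)) \<in> almost_real_rooted_coeffs (Suc n)"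
    unfolding almost_real_rooted_coeffs.simps using p
    by (intro image_eqI[where x = "((s * x, s * y), coeff p)"]) (simp_all only: coeff_linear_mult, auto)
  with n show ?thesis by (intro exI[of _ s]) (simp add: s_def)
qed

text \<open>Real roots are split off one at a time, with rescaling after each step, until a factor
  of degree at most 2 remains.\<close>

lemma almost_real_rooted_coeffsI:
  fixes p :: "real poly"
  assumes "p \<noteq> 0" "degree p \<le> n + 2" "degree p \<le> card {t. poly p t = 0} + 2"
  shows "\<exists>s. s \<noteq> 0 \<and> coeff (smult s p) \<in> almost_real_rooted_coeffs n"
  using assms
proof (induction n arbitrary: p)
  case 0
  define x y z where "x = coeff p 0" and "y = coeff p 1" and "z = coeff p 2"
  have p: "p = [:x, y, z:]"
  proof (rule poly_eqI)
    fix i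
    show "coeff p i = coeff [:x, y, z:] i"
      unfolding coeff_quadratic x_def y_def z_def using 0(2) by (simp add: coeff_eq_0)
  qed
  define s where "s = 1 / norm (x, y, z)"
  have "(x, y, z) \<noteq> 0" using p 0(1) by (auto simp: zero_prod_def)
  then have n: "norm (x, y, z) \<noteq> 0" by simp
  have "norm (s *\<^sub>R (x, y, z)) = 1" unfolding norm_scaleR s_def using n by simp
  then have "(s * x, s * y, s * z) \<in> sphere 0 1" by simp
  then have "coeff [:s * x, s * y, s * z:] \<in> almost_real_rooted_coeffs 0"
    unfolding almost_real_rooted_coeffs.simps coeff_quadratic by (rule rev_image_eqI) auto
  with p n show ?case by (intro exI[of _ s]) (simp add: s_def)
next
  case (Suc n)
  have fin: "finite {t. poly p t = 0}" using Suc.prems(1) by (rule poly_roots_finite)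
  show ?case
  proof (cases "{t. poly p t = 0} = {}")
    case True
    have "degree p \<le> n + 2" using Suc.prems(3) unfolding True by simp
    then obtain s where s: "s \<noteq> 0" "coeff (smult s p) \<in> almost_real_rooted_coeffs n"
      using Suc.IH[OF Suc.prems(1) _ Suc.prems(3)] by blast
    \<comment> \<open>Without real roots the degree is at most 2, and the constant 1 serves as the
      additional linear factor.\<close>
    from almost_real_rooted_coeffs_mult[OF s(2), of 1 0] obtain s' where
      "s' \<noteq> 0" "coeff (smult s' ([:1, 0:] * smult s p)) \<in> almost_real_rooted_coeffs (Suc n)" by auto
    with s(1) show ?thesis by (intro exI[of _ "s' * s"] conjI) (simp_all del: coeff_smult)
  next
    case False
    then obtain t where t: "poly p t = 0" by auto
    then obtain q where q: "p = [:-t, 1:] * q" unfolding poly_eq_0_iff_dvd by (meson dvdE)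
    with Suc.prems(1) have q0: "q \<noteq> 0" by auto
    have dp: "degree p = Suc (degree q)" unfolding q using q0 by (subst degree_mult_eq) auto
    \<comment> \<open>Dividing by X - t loses at most the root t, and the degree drops by one as
      well, so the bound on the degree is inherited.\<close>
    have "{x. poly p x = 0} - {t} \<subseteq> {x. poly q x = 0}" by (auto simp: q)
    from card_mono[OF poly_roots_finite[OF q0] this] have "degree q \<le> card {x. poly q x = 0} + 2"
      using dp Suc.prems(3) t fin by simp
    moreover have "degree q \<le> n + 2" using dp Suc.prems(2) by simp
    ultimately obtain s where s: "s \<noteq> 0" "coeff (smult s q) \<in> almost_real_rooted_coeffs n"
      using Suc.IH[OF q0] by blast
    from almost_real_rooted_coeffs_mult[OF s(2), of "-t" 1] obtain s' where
      s': "s' \<noteq> 0" "coeff (smult s' ([:-t, 1:] * smult s q)) \<in> almost_real_rooted_coeffs (Suc n)" by auto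
    have "smult s' ([:-t, 1:] * smult s q) = smult (s' * s) p"
      unfolding q by (simp only: mult_smult_right smult_smult)
    with s(1) s' show ?thesis by (intro exI[of _ "s' * s"] conjI) (simp_all del: coeff_smult)
  qed
qed

section \<open>Perturbation of the Hankel equations\<close>

lemma tendsto_coord: "((\<lambda>b :: nat \<Rightarrow> real. b i) \<longlongrightarrow> b0 i) (nhds b0)"
proof -
  have "continuous_on UNIV (\<lambda>b :: nat \<Rightarrow> real. b i)"
    by (rule continuous_on_product_then_coordinatewise) (rule continuous_on_id)
  then have "isCont (\<lambda>b. b i) b0" unfolding continuous_on_eq_continuous_at[OF open_UNIV] by blast
  then show ?thesis unfolding isCont_def by (rule tendsto_at_iff_tendsto_nhds[THEN iffD1])
qed

text \<open>A nonzero pairing is an open condition on the pair (b, f), and f ranges over a compact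
  set, so one neighbourhood of b0 works for all f.\<close>

lemma eventually_no_apolar_almost_real_rooted:
  assumes "\<And>f. f \<in> almost_real_rooted_coeffs n \<Longrightarrow> \<exists>m\<le>e. hankel d k m b0 f \<noteq> 0"
  shows "\<forall>\<^sub>F b in nhds b0. \<forall>f\<in>almost_real_rooted_coeffs n. \<exists>m\<le>e. hankel d k m b f \<noteq> 0"
proof -
  let ?W = "\<Union>m\<le>e. {z. hankel d k m (fst z) (snd z) \<noteq> 0}"
  have c: "continuous_on UNIV (\<lambda>z :: (nat \<Rightarrow> real) \<times> (nat \<Rightarrow> real). fst z j)"
    "continuous_on UNIV (\<lambda>z :: (nat \<Rightarrow> real) \<times> (nat \<Rightarrow> real). snd z j)" for j
    by (rule continuous_on_product_then_coordinatewise, intro continuous_intros)+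
  have "open ?W"
    unfolding hankel_def by (intro open_UN ballI open_Collect_neq continuous_intros c)
  moreover have "{b0} \<times> almost_real_rooted_coeffs n \<subseteq> ?W"
    using assms by (simp add: subset_iff Bex_def)
  ultimately obtain X where X: "b0 \<in> X" "open X" "X \<times> almost_real_rooted_coeffs n \<subseteq> ?W"
    using Elementary_Topology.tube_lemma[OF compact_almost_real_rooted_coeffs, of ?W b0 n] by blast
  show ?thesis
    unfolding eventually_nhds
  proof (intro exI[of _ X] conjI X ballI)
    fix b f assume "b \<in> X" "f \<in> almost_real_rooted_coeffs n"
    then have "(b, f) \<in> ?W" using X(3) by blast
    then show "\<exists>m\<le>e. hankel d k m b f \<noteq> 0" by auto
  qed
qed

lemma tendsto_hankel:
  assumes "\<And>i. ((\<lambda>b. v b i) \<longlongrightarrow> v0 i) (nhds b0)"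
  shows "((\<lambda>b. hankel d k m b (v b)) \<longlongrightarrow> hankel d k m b0 v0) (nhds b0)"
  unfolding hankel_def by (intro tendsto_intros assms tendsto_coord)

lemma hankel_diff_scale:
  "hankel d k m b (\<lambda>i. v i - c * w i) = hankel d k m b v - c * hankel d k m b w"
  by (simp add: hankel_def left_diff_distrib sum_subtractf sum_distrib_left mult.assoc)

(* Gaussian elimination depending continuously on the equations. *)
lemma continuous_kernel_vector:
  assumes w: "\<And>m. m < n \<Longrightarrow> hankel d k m b0 (w m) \<noteq> 0"
      "\<And>m i. m < n \<Longrightarrow> i < m \<Longrightarrow> hankel d k i b0 (w m) = 0"
    and v0: "\<And>m. m < n \<Longrightarrow> hankel d k m b0 v0 = 0"
  shows "\<exists>v. (\<forall>i. ((\<lambda>b. v b i) \<longlongrightarrow> v0 i) (nhds b0)) \<and>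
             (\<forall>\<^sub>F b in nhds b0. \<forall>m<n. hankel d k m b (v b) = 0)"
  using assms
proof (induction n arbitrary: v0)
  case 0
  show ?case by (intro exI[of _ "\<lambda>b. v0"]) auto
next
  case (Suc n)
  have IH: "\<exists>v. (\<forall>i. ((\<lambda>b. v b i) \<longlongrightarrow> x i) (nhds b0)) \<and>
             (\<forall>\<^sub>F b in nhds b0. \<forall>m<n. hankel d k m b (v b) = 0)"
    if "\<And>m. m < n \<Longrightarrow> hankel d k m b0 x = 0" for x
    using that by (intro Suc.IH) (use Suc.prems(1,2) less_SucI in blast)+
  obtain v where v: "\<And>i. ((\<lambda>b. v b i) \<longlongrightarrow> v0 i) (nhds b0)"
      "\<forall>\<^sub>F b in nhds b0. \<forall>m<n. hankel d k m b (v b) = 0"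
    using IH[of v0] Suc.prems(3) less_SucI by blast
  obtain u where u: "\<And>i. ((\<lambda>b. u b i) \<longlongrightarrow> w n i) (nhds b0)"
      "\<forall>\<^sub>F b in nhds b0. \<forall>m<n. hankel d k m b (u b) = 0"
    using IH[of "w n"] Suc.prems(2) by blast
  \<comment> \<open>Subtracting c times u enforces equation n without disturbing the earlier ones,
    which v and u both satisfy. At b0 the numerator tends to 0 and the denominator does not, so the
    correction vanishes in the limit.\<close>
  define c where "c b = hankel d k n b (v b) / hankel d k n b (u b)" for b
  have u0: "((\<lambda>b. hankel d k n b (u b)) \<longlongrightarrow> hankel d k n b0 (w n)) (nhds b0)"
    by (rule tendsto_hankel[OF u(1)])
  have ne: "hankel d k n b0 (w n) \<noteq> 0" using Suc.prems(1) by blast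
  have "(c \<longlongrightarrow> hankel d k n b0 v0 / hankel d k n b0 (w n)) (nhds b0)"
    unfolding c_def by (intro tendsto_divide tendsto_hankel v u ne)
  then have c0: "(c \<longlongrightarrow> 0) (nhds b0)" using Suc.prems(3)[of n] by simp
  have lim: "((\<lambda>b. v b i - c b * u b i) \<longlongrightarrow> v0 i) (nhds b0)" for i
    using tendsto_diff[OF v(1)[of i] tendsto_mult[OF c0 u(1)[of i]]] by simp
  have "\<forall>\<^sub>F b in nhds b0. hankel d k n b (u b) \<noteq> 0"
    using tendsto_imp_eventually_ne[OF u0 ne] .
  with v(2) u(2)
  have "\<forall>\<^sub>F b in nhds b0. \<forall>m<Suc n. hankel d k m b (\<lambda>i. v b i - c b * u b i) = 0"
  proof eventually_elim
    case (elim b)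
    then show ?case unfolding less_Suc_eq hankel_diff_scale c_def by auto
  qed
  with lim show ?case by (intro exI[of _ "\<lambda>b i. v b i - c b * u b i"]) blast
qed

section \<open>Persistence of real roots\<close>

text \<open>Factors with the same j combine to (i - j)^2 - 1/4, which is negative for j = i
  only.\<close>

lemma prod_linear_sign_change:
  assumes "i < r"
  shows "poly (\<Prod>j<r. [:- real j, 1:]) (real i - 1/2) * poly (\<Prod>j<r. [:- real j, 1:]) (real i + 1/2) < 0"
proof -
  have "poly (\<Prod>j<r. [:- real j, 1:]) (real i - 1/2) * poly (\<Prod>j<r. [:- real j, 1:]) (real i + 1/2)
      = (\<Prod>j<r. (real i - real j)\<^sup>2 - 1/4)"
    unfolding poly_prod prod.distrib[symmetric]
    by (rule prod.cong) (auto simp: power2_eq_square field_simps)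
  also have "\<dots> = - 1/4 * (\<Prod>j\<in>{..<r} - {i}. (real i - real j)\<^sup>2 - 1/4)"
    using assms by (subst prod.remove[of _ i]) auto
  also have "\<dots> < 0"
  proof -
    have "(real i - real j)\<^sup>2 - 1/4 > 0" if "j \<noteq> i" for j
    proof -
      have "1 \<le> \<bar>real i - real j\<bar>" using that by linarith
      then have "1 \<le> (real i - real j)\<^sup>2" using abs_le_square_iff[of 1 "real i - real j"] by simp
      then show ?thesis by simp
    qed
    then have "(\<Prod>j\<in>{..<r} - {i}. (real i - real j)\<^sup>2 - 1/4) > 0" by (intro prod_pos) auto
    then show ?thesis by simp
  qed
  finally show ?thesis .
qed

lemma degree_prod_linear: "degree (\<Prod>j<r. [:- real j, 1:]) = r"
  by (subst degree_prod_eq_sum_degree) auto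

text \<open>The sign changes between consecutive half-integers involve finitely many values, so they
  persist. The intermediate value theorem then gives one root in each of r disjoint
  intervals.\<close>

lemma eventually_distinct_real_roots:
  fixes v :: "'a \<Rightarrow> nat \<Rightarrow> real"
  assumes "\<And>i. ((\<lambda>b. v b i) \<longlongrightarrow> coeff (\<Prod>j<r. [:- real j, 1:]) i) F"
  shows "\<forall>\<^sub>F b in F. \<exists>T. finite T \<and> card T = r \<and> (\<forall>t\<in>T. poly (\<Sum>i\<le>r. monom (v b i) i) t = 0)"
proof -
  define q where "q = (\<Prod>j<r. [:- real j, 1:])"
  define p where "p b = (\<Sum>i\<le>r. monom (v b i) i)" for b
  have lim: "((\<lambda>b. poly (p b) x) \<longlongrightarrow> poly q x) F" for x
  proof -
    have "((\<lambda>b. \<Sum>i\<le>r. v b i * x ^ i) \<longlongrightarrow> (\<Sum>i\<le>r. coeff q i * x ^ i)) F"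
      unfolding q_def by (intro tendsto_intros assms)
    moreover have "poly q x = (\<Sum>i\<le>r. coeff q i * x ^ i)"
      using degree_prod_linear[of r] by (simp add: poly_altdef q_def)
    ultimately show ?thesis by (simp add: p_def poly_sum poly_monom)
  qed
  have "\<forall>\<^sub>F b in F. poly (p b) (real i - 1/2) * poly (p b) (real i + 1/2) < 0" if "i < r" for i
  proof (rule order_tendstoD(2))
    show "((\<lambda>b. poly (p b) (real i - 1/2) * poly (p b) (real i + 1/2))
        \<longlongrightarrow> poly q (real i - 1/2) * poly q (real i + 1/2)) F"
      by (intro tendsto_mult lim)
    show "poly q (real i - 1/2) * poly q (real i + 1/2) < 0"
      unfolding q_def by (rule prod_linear_sign_change[OF that])
  qed
  then have "\<forall>\<^sub>F b in F. \<forall>i\<in>{..<r}. poly (p b) (real i - 1/2) * poly (p b) (real i + 1/2) < 0"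
    by (intro eventually_ball_finite) auto
  then show ?thesis
  proof eventually_elim
    case (elim b)
    have "\<exists>x. real i - 1/2 < x \<and> x < real i + 1/2 \<and> poly (p b) x = 0" if "i < r" for i
      using elim that by (intro poly_IVT) auto
    then obtain x where x: "\<And>i. i < r \<Longrightarrow> real i - 1/2 < x i \<and> x i < real i + 1/2 \<and> poly (p b) (x i) = 0"
      by metis
    have "inj_on x {..<r}"
    proof (rule inj_onI)
      fix i j assume "i \<in> {..<r}" "j \<in> {..<r}" "x i = x j"
      with x[of i] x[of j] show "i = j" by auto
    qed
    then have "card (x ` {..<r}) = r" by (simp add: card_image)
    with x show ?case unfolding p_def[symmetric] by (intro exI[of _ "x ` {..<r}"]) auto
  qed
qed

section \<open>The center of the open set\<close>

lemma hankel_cong: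
  "(\<And>i. i \<le> k \<Longrightarrow> f i = g i) \<Longrightarrow> hankel d k m b f = hankel d k m b g"
  by (simp add: hankel_def)

lemma ex_typical_center:
  assumes "d \<ge> 5" "(d + 2) div 2 \<le> r" "r \<le> d - 2"
  obtains b0 where "\<And>i. d < i \<Longrightarrow> b0 i = 0"
    and "\<And>f. f \<in> almost_real_rooted_coeffs (r - 3) \<Longrightarrow> \<exists>m\<le>d - (r - 1). hankel d (r - 1) m b0 f \<noteq> 0"
    and "\<forall>\<^sub>F b in nhds b0. \<exists>p T. degree p \<le> r \<and> p \<noteq> 0 \<and> finite T \<and> card T = r \<and>
           (\<forall>t\<in>T. poly p t = 0) \<and> (\<forall>m\<le>d - r. hankel d r m b (coeff p) = 0)"
proof -
  define a where "a = d + 2 - r"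
  \<comment> \<open>There are a equations in degree r - 1 and a - 1 in degree r. The upper bound on
    r leaves room for a quartic in g; the lower bound makes residues modulo g have degree at most
    r.\<close>
  have a: "4 \<le> a" "a - 1 \<le> r" "3 \<le> r" "d - (r - 1) = a - 1" "d - r = a - 2" "r + a = d + 2"
    using assms by (auto simp: a_def)
  define P :: "real poly" where "P = [:1, 0, 0, 0, 1:]"
  \<comment> \<open>The power of X + 1 fills the degree up to a without creating a root at 0, ..., r
    - 1.\<close>
  define g where "g = P * [:1, 1:] ^ (a - 4)"
  have P: "2 < degree P" "poly P t \<noteq> 0" for t
  proof -
    have "poly P t = 1 + (t\<^sup>2)\<^sup>2" by (simp add: P_def power2_eq_square)
    also have "\<dots> > 0" by (rule add_pos_nonneg) simp_all
    finally show "poly P t \<noteq> 0" by simp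
  qed (simp add: P_def)
  have dg: "degree g = a"
    unfolding g_def using P(1) a(1)
    by (subst degree_mult_eq) (auto simp: degree_power_eq P_def)
  have "poly g (real j) \<noteq> 0" for j
    using P(2) by (simp add: g_def add_nonneg_eq_0_iff)
  define q where "q = (\<Prod>j<r. [:- real j, 1:])"
  obtain u where u: "g dvd u * q - 1"
    using ex_inverse_mod_prod_linear[of "{..<r}" g real] \<open>\<And>j. poly g (real j) \<noteq> 0\<close>
    unfolding q_def by auto
  \<comment> \<open>The denominators cancel the factorials in \<open>hankel\<close>.\<close>
  define b0 where "b0 i =
    (if i \<le> d then coeff ((u * monom 1 i) mod g) (a - 1) / (fact i * fact (d - i)) else 0)" for i
  have hk: "hankel d n m b0 (coeff p) = coeff ((u * p * monom 1 m) mod g) (a - 1)"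
    if "degree p \<le> n" "n + m \<le> d" for n m p
  proof -
    have "hankel d n m b0 (coeff p) = (\<Sum>i\<le>n. coeff p i * coeff ((u * monom 1 (i + m)) mod g) (a - 1))"
      unfolding hankel_def using that(2) by (intro sum.cong) (auto simp: b0_def)
    then show ?thesis using sum_coeff_residue[OF that(1)] by simp
  qed
  have low: "\<exists>m\<le>d - (r - 1). hankel d (r - 1) m b0 f \<noteq> 0" if f: "f \<in> almost_real_rooted_coeffs (r - 3)" for f
  proof (rule ccontr)
    assume *: "\<not> ?thesis"
    obtain p where p: "f = coeff p" "degree p \<le> r - 3 + 2" "\<not> P dvd p"
      using almost_real_rooted_coeffsE[OF f P] by blast
    have "g dvd u * p"
    proof (rule dvd_if_top_coeffs_0[OF dg])
      fix m assume "m < a"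
      then have "hankel d (r - 1) m b0 (coeff p) = 0" using * a p(1) by auto
      then show "coeff ((u * p * monom 1 m) mod g) (a - 1) = 0"
        using p(2) a \<open>m < a\<close> by (subst (asm) hk) auto
    qed (use a in simp)
    \<comment> \<open>Multiplication by q undoes u modulo g, so g divides p itself.\<close>
    then have "g dvd q * (u * p) - (u * q - 1) * p" using u by (intro dvd_diff) auto
    also have "q * (u * p) - (u * q - 1) * p = p" by (simp add: algebra_simps)
    finally have "P dvd p" unfolding g_def by (rule dvd_mult_left)
    with p(3) show False by blast
  qed
  \<comment> \<open>As u inverts q, the i-th pairing of \<open>w m\<close> is the coefficient at
    X^(a-1) of X^(a-1-m+i). It is 1 for i = m and 0 for i < m: the triangular system that the
    elimination requires.\<close>
  define w where "w m = (q * monom 1 (a - 1 - m)) mod g" for m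
  have dw: "degree (w m) \<le> r" for m
  proof -
    have "degree (w m) < a" if "w m \<noteq> 0"
      using that a(1) unfolding w_def by (subst dg[symmetric], intro degree_mod_less') (auto simp: dg[symmetric])
    then show ?thesis using a(1,2) by (cases "w m = 0") auto
  qed
  have monom_mod: "monom 1 n mod g = monom 1 n" if "n < a" for n
    using that by (intro mod_poly_less) (simp add: dg degree_monom_eq)
  have hw: "hankel d r i b0 (coeff (w m)) = (if i = m then 1 else 0)" if "i \<le> m" "m < a - 1" for i m
  proof -
    have "hankel d r i b0 (coeff (w m)) = coeff ((u * w m * monom 1 i) mod g) (a - 1)"
      using that a by (intro hk dw) auto
    also have "(u * w m * monom 1 i) mod g = (u * q * (monom 1 (a - 1 - m) * monom 1 i)) mod g"
      unfolding w_def by (metis (no_types, opaque_lifting) mod_mult_left_eq mod_mult_right_eq mult.assoc)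
    also have "\<dots> = monom 1 (a - 1 - m + i) mod g"
      by (simp add: poly_mod_mult_one[OF u] mult_monom)
    also have "\<dots> = monom 1 (a - 1 - m + i)" using that by (intro monom_mod) auto
    finally show ?thesis using that by auto
  qed
  have hq: "hankel d r m b0 (coeff q) = 0" if "m < a - 1" for m
  proof -
    have "hankel d r m b0 (coeff q) = coeff ((u * q * monom 1 m) mod g) (a - 1)"
      using that a by (intro hk) (auto simp: q_def degree_prod_linear)
    with that show ?thesis by (simp add: poly_mod_mult_one[OF u] monom_mod)
  qed
  obtain v where v: "\<And>i. ((\<lambda>b. v b i) \<longlongrightarrow> coeff q i) (nhds b0)"
      "\<forall>\<^sub>F b in nhds b0. \<forall>m<a - 1. hankel d r m b (v b) = 0"
    using continuous_kernel_vector[of "a - 1" d r b0 "\<lambda>m. coeff (w m)" "coeff q"] hw hq by auto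
  \<comment> \<open>The leading coefficient of q is 1, so nearby polynomials are nonzero.\<close>
  have "((\<lambda>b. v b r) \<longlongrightarrow> 1) (nhds b0)"
    using v(1)[of r] lead_coeff_prod[of "\<lambda>j. [:- real j, 1:]" "{..<r}"]
    by (simp add: q_def degree_prod_linear)
  then have "\<forall>\<^sub>F b in nhds b0. v b r \<noteq> 0" by (rule tendsto_imp_eventually_ne) simp
  with v(2) eventually_distinct_real_roots[OF v(1)[unfolded q_def]]
  have "\<forall>\<^sub>F b in nhds b0. \<exists>p T. degree p \<le> r \<and> p \<noteq> 0 \<and> finite T \<and> card T = r \<and>
           (\<forall>t\<in>T. poly p t = 0) \<and> (\<forall>m\<le>d - r. hankel d r m b (coeff p) = 0)"
  proof eventually_elim
    case (elim b)
    define p where "p = (\<Sum>i\<le>r. monom (v b i) i)"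
    have cp: "coeff p i = (if i \<le> r then v b i else 0)" for i
      by (simp add: p_def coeff_sum)
    obtain T where "finite T" "card T = r" "\<forall>t\<in>T. poly p t = 0" using elim(2) unfolding p_def by blast
    moreover have "degree p \<le> r" by (rule degree_le) (simp add: cp)
    moreover have "p \<noteq> 0" using elim(3) cp[of r] by auto
    moreover have "hankel d r m b (coeff p) = 0" if "m \<le> d - r" for m
      using that elim(1) a hankel_cong[of r "coeff p" "v b"] by (simp add: cp)
    ultimately show ?case by blast
  qed
  with low show thesis by (intro that[of b0]) (auto simp: b0_def)
qed

section \<open>The open set of forms of rank r\<close>

lemma openin_Euclidean_space_iff:
  "openin (Euclidean_space n) S \<longleftrightarrow> (\<exists>T. open T \<and> S = T \<inter> {x. \<forall>i\<ge>n. x i = 0})"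
  unfolding Euclidean_space_def openin_subtopology open_fun_def ..

theorem theorem7p9:
  fixes d r :: nat
  assumes "d \<ge> 5" and "(d + 2) div 2 \<le> r" and "r \<le> d - 2"
  shows "typical_ar_rank d r"
proof -
  have r: "3 \<le> r" using assms by auto
  obtain b0 where b0: "\<And>i. d < i \<Longrightarrow> b0 i = 0"
    and low: "\<And>f. f \<in> almost_real_rooted_coeffs (r - 3) \<Longrightarrow> \<exists>m\<le>d - (r - 1). hankel d (r - 1) m b0 f \<noteq> 0"
    and up: "\<forall>\<^sub>F b in nhds b0. \<exists>p T. degree p \<le> r \<and> p \<noteq> 0 \<and> finite T \<and> card T = r \<and>
           (\<forall>t\<in>T. poly p t = 0) \<and> (\<forall>m\<le>d - r. hankel d r m b (coeff p) = 0)"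
    using ex_typical_center[OF assms] by blast
  from eventually_conj[OF up eventually_no_apolar_almost_real_rooted[OF low]]
  obtain S where S: "open S" "b0 \<in> S"
    and S_up: "\<And>b. b \<in> S \<Longrightarrow> \<exists>p T. degree p \<le> r \<and> p \<noteq> 0 \<and> finite T \<and> card T = r \<and>
           (\<forall>t\<in>T. poly p t = 0) \<and> (\<forall>m\<le>d - r. hankel d r m b (coeff p) = 0)"
    and S_low: "\<And>b f. b \<in> S \<Longrightarrow> f \<in> almost_real_rooted_coeffs (r - 3) \<Longrightarrow>
           \<exists>m\<le>d - (r - 1). hankel d (r - 1) m b f \<noteq> 0"
    unfolding eventually_nhds by metis
  define U where "U = {F \<in> forms d. form_coeffs d F \<in> S}"
  have img: "form_coeffs d ` forms d = {x. \<forall>i\<ge>d + 1. x i = 0}"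
    using bij_betw_form_coeffs[of d] by (simp add: bij_betw_def topspace_Euclidean_space)
  then have imgU: "form_coeffs d ` U = S \<inter> {x. \<forall>i\<ge>d + 1. x i = 0}"
    by (auto simp: U_def)
  have "open_forms d U"
    unfolding open_forms_def openin_Euclidean_space_iff imgU using S(1) unfolding U_def by blast
  moreover have "b0 \<in> form_coeffs d ` U"
    unfolding imgU using S(2) b0 by auto
  then have "U \<noteq> {}" by auto
  moreover have "F \<noteq> 0 \<and> ar_rk F = r" if "F \<in> U" for F
  proof
    define b where "b = form_coeffs d F"
    have F: "F \<in> forms d" and b: "b \<in> S" using that by (auto simp: U_def b_def)
    \<comment> \<open>A multiple of the constant polynomial 1 belongs to the compact set; its
      nonzero pairing with b shows that b is not zero.\<close>
    obtain s where "coeff (smult s 1) \<in> almost_real_rooted_coeffs (r - 3)"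
      using almost_real_rooted_coeffsI[of 1 "r - 3"] by (auto simp del: coeff_smult)
    from S_low[OF b this] obtain m f where m: "hankel d (r - 1) m b f \<noteq> 0" by blast
    show "F \<noteq> 0"
    proof
      assume "F = 0"
      then have "b = (\<lambda>i. 0)" by (auto simp: b_def form_coeffs_def bicoeff_def)
      with m show False by (simp add: hankel_def)
    qed
    show "ar_rk F = r"
      unfolding ar_rk_def
    proof (rule Least_equality)
      obtain p T where p: "degree p \<le> r" "p \<noteq> 0" "finite T" "card T = r" "\<forall>t\<in>T. poly p t = 0"
        and h: "\<forall>m\<le>d - r. hankel d r m b (coeff p) = 0"
        using S_up[OF b] by blast
      have "hankel d r m b (\<lambda>i. bicoeff (homogenize r p) i (r - i)) = hankel d r m b (coeff p)" for m
        by (rule hankel_cong) (simp add: bicoeff_homogenize)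
      then have "homogenize r p \<in> apolar_ideal F"
        using h assms(3) by (subst apolar_iff_hankel[OF homogenize_in_forms F]) (auto simp: b_def)
      moreover have "almost_real_roots r (homogenize r p)"
        by (rule almost_real_roots_homogenize[OF p(1-4)]) (use p(5) in blast)
      ultimately show "\<exists>g\<in>apolar_ideal F \<inter> forms r. almost_real_roots r g"
        using homogenize_in_forms by blast
    next
      fix k assume "\<exists>g\<in>apolar_ideal F \<inter> forms k. almost_real_roots k g"
      then obtain g where g: "g \<in> apolar_ideal F" "g \<in> forms k" "almost_real_roots k g" by blast
      show "r \<le> k"
      proof (rule ccontr)
        assume "\<not> r \<le> k"
        then have k: "k \<le> r - 1" "k \<le> d" using assms(3) by auto
        have "g \<noteq> 0" using g(3) by (simp add: almost_real_roots_def)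
        then have "poly g 1 \<noteq> 0" using dehomogenize_eq_0_iff[OF g(2)] by blast
        \<comment> \<open>Dehomogenizing forgets powers of y, so all degrees k < r are treated at
          once in degree r - 1, which is \<open>r - 3 + 2\<close>.\<close>
        moreover have "degree (poly g 1) \<le> r - 3 + 2"
          using degree_dehomogenize[OF g(2)] k(1) r by linarith
        ultimately have "\<exists>s. s \<noteq> 0 \<and> coeff (smult s (poly g 1)) \<in> almost_real_rooted_coeffs (r - 3)"
          using almost_real_roots_dehomogenize[OF g(3)] by (rule almost_real_rooted_coeffsI)
        then obtain s where "coeff (smult s (poly g 1)) \<in> almost_real_rooted_coeffs (r - 3)" by blast
        from S_low[OF b this] obtain m where m: "m \<le> d - (r - 1)"
          and ne: "hankel d (r - 1) m b (coeff (smult s (poly g 1))) \<noteq> 0" by blast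
        have "hankel d (r - 1) m b (coeff (smult s (poly g 1)))
            = s * hankel d (r - 1) m b (coeff (poly g 1))"
          unfolding hankel_def coeff_smult sum_distrib_left mult.assoc ..
        \<comment> \<open>Padding with zero coefficients does not change the pairing, and m remains
          within the larger range of equations for degree k.\<close>
        also have "hankel d (r - 1) m b (coeff (poly g 1))
            = hankel d k m b (\<lambda>i. bicoeff g i (k - i))"
          unfolding hankel_def coeff_dehomogenize[OF g(2)]
          using k(1) by (intro sum.mono_neutral_cong_right) auto
        also have "\<dots> = 0"
        proof -
          have "m \<le> d - k" using m k by linarith
          then show ?thesis
            using g(1) unfolding apolar_iff_hankel[OF g(2) F k(2)] b_def by blast
        qed
        finally show False using ne by (simp only: mult_zero_right simp_thms)
      qed
    qed
  qed
  ultimately show ?thesis unfolding typical_ar_rank_def by blast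
qed

end
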